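(* For every integer $n\ge0$, $$\sum_{j\ge0}q^{j(j+1)}\begin{bmatrix} n+1\\ 2j+1\end{bmatrix}_{q}=\sum_{k=-\infty}^\infty\left[q^{15k^2+4k}\binom{n+1,\,6k+1;\,q}{6k+1}_2-q^{15k^2+16k+4}\binom{n+1,\,6k+3;\,q}{6k+3}_2\right].$$
   Context: $q$ is an indeterminate. $(a;q)_n=\prod_{i=0}^{n-1}(1-aq^i)$. The Gaussian polynomial is $\begin{bmatrix} A\\ B\end{bmatrix}_{q}=\frac{(q;q)_A}{(q;q)_B(q;q)_{A-B}}$ if $0\le B\le A$, and $0$ otherwise. For integers $L\ge0$, $A$, $B$, the $q$-trinomial coefficient is $$\binom{L,\,B;\,q}{A}_2=\sum_{r\ge0}\frac{q^{r(r+B)}(q;q)_L}{(q;q)_r(q;q)_{r+A}(q;q)_{L-2r-A}}=\sum_{r=0}^L q^{r(r+B)}\begin{bmatrix} L\\ r\end{bmatrix}_{q}\begin{bmatrix} L-r\\ r+A\end{bmatrix}_{q},$$ where terms with a negative subscript in the denominator are zero. All sums have only finitely many nonzero terms. *)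

theory Defs
  imports
    "HOL-Library.Groups_Big_Fun"
    "HOL-Computational_Algebra.Polynomial_Factorial"
begin

text \<open>
  The indeterminate q lives in the field of rational functions \<open>\<rat>(q)\<close>, so that quotients and
  negative powers of q are available. The functions below take q as an argument in an arbitrary
  field; their quotients have the intended meaning only if q is not a root of unity.
\<close>

definition indet :: "rat poly fract" where
  "indet = to_fract [:0, 1:]"

definition qpoch :: "'a::field \<Rightarrow> 'a \<Rightarrow> nat \<Rightarrow> 'a" where
  "qpoch a q n = (\<Prod>i<n. 1 - a * q ^ i)"

definition gauss :: "'a::field \<Rightarrow> int \<Rightarrow> int \<Rightarrow> 'a" where
  "gauss q A B =
     (if 0 \<le> B \<and> B \<le> A
      then qpoch q q (nat A) / (qpoch q q (nat B) * qpoch q q (nat (A - B)))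
      else 0)"

definition qtrinomial_term :: "'a::field \<Rightarrow> nat \<Rightarrow> int \<Rightarrow> int \<Rightarrow> nat \<Rightarrow> 'a" where
  "qtrinomial_term q L B A r =
     (if int r + A < 0 \<or> int L - 2 * int r - A < 0 then 0
      else q powi (int r * (int r + B)) * qpoch q q L /
             (qpoch q q r * qpoch q q (nat (int r + A)) * qpoch q q (nat (int L - 2 * int r - A))))"

text \<open>
  \<^term>\<open>Sum_any\<close> sums over all arguments with a nonzero value, and returns \<open>0\<close> if there are infinitely
  many; the lemmas below rule out the latter.
\<close>

definition qtrinomial :: "'a::field \<Rightarrow> nat \<Rightarrow> int \<Rightarrow> int \<Rightarrow> 'a" where
  "qtrinomial q L B A = Sum_any (qtrinomial_term q L B A)"

lemma qtrinomial_term_nonzeroD: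
  assumes "qtrinomial_term q L B A r \<noteq> 0"
  shows "r \<le> L" and "\<bar>A\<bar> \<le> int L"
  using assms by (auto simp: qtrinomial_term_def split: if_splits)

lemma finite_qtrinomial_term: "finite {r. qtrinomial_term q L B A r \<noteq> 0}"
  by (rule finite_subset[of _ "{..L}"]) (auto dest: qtrinomial_term_nonzeroD)

lemma qtrinomial_eq_0:
  assumes "\<bar>A\<bar> > int L"
  shows "qtrinomial q L B A = 0"
proof -
  have "qtrinomial_term q L B A = (\<lambda>_. 0)"
    using assms qtrinomial_term_nonzeroD(2)[of q L B A] by fastforce
  then show ?thesis by (simp add: qtrinomial_def)
qed

lemma finite_rhs_terms:
  "finite {k::int. f k * qtrinomial q L (6*k+1) (6*k+1) - g k * qtrinomial q L (6*k+3) (6*k+3) \<noteq> 0}"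
proof (rule finite_subset[of _ "{- int L - 3..int L + 3}"])
  show "{k. f k * qtrinomial q L (6*k+1) (6*k+1) - g k * qtrinomial q L (6*k+3) (6*k+3) \<noteq> 0}
          \<subseteq> {- int L - 3..int L + 3}"
  proof (rule subsetI, rule ccontr)
    fix k :: int
    assume k: "k \<in> {k. f k * qtrinomial q L (6*k+1) (6*k+1) - g k * qtrinomial q L (6*k+3) (6*k+3) \<noteq> 0}"
      and "k \<notin> {- int L - 3..int L + 3}"
    then have "\<bar>6*k+1\<bar> > int L" "\<bar>6*k+3\<bar> > int L" by auto
    then show False using k by (simp add: qtrinomial_eq_0)
  qed
qed simp

lemma finite_lhs_terms: "finite {j::nat. f j * gauss q (int n + 1) (2 * int j + 1) \<noteq> 0}"
  by (rule finite_subset[of _ "{..n}"]) (auto simp: gauss_def split: if_splits)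

lemma indet_power_neq_1: "n > 0 \<Longrightarrow> indet ^ n \<noteq> 1"
proof
  assume n: "n > 0" and *: "indet ^ n = 1"
  have "to_fract ([:0, 1:] ^ n) = indet ^ n" for n
    by (induction n) (simp_all only: power_0 power_Suc to_fract_mult to_fract_1 indet_def)
  with * have "([:0, 1:] ^ n :: rat poly) = 1"
    by (metis to_fract_1 to_fract_eq_iff)
  then have "degree ([:0, 1:] ^ n :: rat poly) = 0" by simp
  with n show False by (simp add: degree_power_eq)
qed

lemma qpoch_nonzero:
  assumes "\<And>n. n > 0 \<Longrightarrow> q ^ n \<noteq> 1"
  shows "qpoch q q n \<noteq> 0"
proof -
  have "1 - q * q ^ i \<noteq> 0" for i using assms[of "Suc i"] by simp
  then show ?thesis by (simp add: qpoch_def)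
qed

lemma qtrinomial_gauss:
  assumes "\<And>n. n > 0 \<Longrightarrow> q ^ n \<noteq> 1"
  shows "qtrinomial q L B A =
    (\<Sum>r\<le>L. q powi (int r * (int r + B)) * gauss q (int L) (int r)
             * gauss q (int L - int r) (int r + A))"
proof -
  have "qtrinomial q L B A = (\<Sum>r\<le>L. qtrinomial_term q L B A r)"
    unfolding qtrinomial_def
    by (rule Sum_any.expand_superset) (auto dest: qtrinomial_term_nonzeroD)
  also have "\<dots> = (\<Sum>r\<le>L. q powi (int r * (int r + B)) * gauss q (int L) (int r)
             * gauss q (int L - int r) (int r + A))"
  proof (rule sum.cong[OF refl])
    fix r assume "r \<in> {..L}"
    then have r: "r \<le> L" by simp
    have e: "int L - int r - (int r + A) = int L - 2 * int r - A" by simp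
    show "qtrinomial_term q L B A r = q powi (int r * (int r + B)) * gauss q (int L) (int r)
             * gauss q (int L - int r) (int r + A)"
      using r qpoch_nonzero[OF assms]
      by (auto simp: qtrinomial_term_def gauss_def e field_simps)
  qed
  finally show ?thesis .
qed

end

theory Submission
  imports Defs
begin

text \<open>
  For equal parameters the \<open>q\<close>-trinomial coefficient is symmetric in its indices: writing \<open>s = r + A\<close>, its terms are
  \<open>q ^ (r * s)\<close> times the \<open>q\<close>-multinomial coefficient of \<open>L\<close> into parts \<open>r\<close>, \<open>s\<close> and \<open>L - r - s\<close>.
  Choosing \<open>m = r + s\<close> first splits off a factor \<open>gauss q L m\<close>, and \<open>m = 2 * j + 1\<close> is odd because
  only odd \<open>A\<close> occur (lemma \<open>qtrinomial_odd_eq_sum\<close>). After interchanging the sums and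
  pulling out \<open>q ^ (j * (j + 1))\<close>, the coefficient of \<open>gauss q L (2 * j + 1)\<close> on the right is

  \<open>\<Sum>k. q powi (6*k\<^sup>2 + k) * gauss q (2*j + 1) (j - 3*k)
      - q powi (6*k\<^sup>2 + 7*k + 2) * gauss q (2*j + 1) (j - 1 - 3*k)\<close>

  and the theorem reduces to the claim that this is \<open>1\<close> for every \<open>j\<close>. That is the odd case of
  Schur's polynomial version of the pentagonal number theorem,
  \<open>\<Sum>l. (-1) powi l * q powi (l * (3*l + 1) div 2) * gauss q n ((n - 3*l) div 2) = 1\<close>, where
  \<open>l = 2 * k\<close> and \<open>l = 2 * k + 1\<close> give the two families. It is proved by induction on \<open>n\<close>: with the
  right choice of \<open>q\<close>-Pascal rule in each term, the terms of the difference between \<open>n + 1\<close> and \<open>n\<close>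
  cancel in pairs. The pair consists of \<open>2 * k\<close> and \<open>2 * k + 1\<close> when \<open>n\<close> is even, and of \<open>2 * k + 1\<close>
  and \<open>2 * k + 2\<close> when \<open>n\<close> is odd; in the form used here, two steps of the induction change
  each summand by a telescoping difference (lemma \<open>schur_term_step\<close>).
\<close>

lemma qpoch_Suc: "qpoch q q (Suc n) = qpoch q q n * (1 - q ^ Suc n)"
  by (simp add: qpoch_def)

lemma gauss_outside: "B < 0 \<or> A < B \<Longrightarrow> gauss q A B = 0"
  by (auto simp: gauss_def)

lemma gauss_sym: "gauss q A (A - B) = gauss q A B"
  by (auto simp: gauss_def mult.commute)

locale non_root_of_unity =
  fixes q :: "'a::field"
  assumes q_nonzero: "q \<noteq> 0"
    and q_power_neq_1: "\<And>n. n > 0 \<Longrightarrow> q ^ n \<noteq> 1"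
begin

lemma qpoch_neq_0 [simp]: "qpoch q q n \<noteq> 0"
  by (rule qpoch_nonzero) (rule q_power_neq_1)

lemma gauss_0_right: "A \<ge> 0 \<Longrightarrow> gauss q A 0 = 1"
  by (simp add: gauss_def qpoch_def[of q q 0])

lemma gauss_self: "A \<ge> 0 \<Longrightarrow> gauss q A A = 1"
  using gauss_sym[of q A 0] by (simp add: gauss_0_right)

text \<open>
  The rule holds for all integers \<open>B\<close>, including the boundary values at which a coefficient vanishes;
  this is what allows sums over all integers to be rearranged without tracking their ranges.
\<close>

lemma gauss_pascal_upper:
  assumes "A \<ge> 0"
  shows "gauss q (A + 1) B = gauss q A B + q powi (A + 1 - B) * gauss q A (B - 1)"
proof -
  consider "B < 0 \<or> B > A + 1" | "B = 0" | "B = A + 1" | "1 \<le> B" "B \<le> A" by linarith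
  then show ?thesis
  proof cases
    case 4
    define b where "b = nat (B - 1)"
    define c where "c = nat (A - B)"
    have B: "B = int b + 1" and A: "A = int b + 1 + int c"
      using 4 by (simp_all add: b_def c_def)
    have nats: "nat A = Suc (b + c)" "nat (A + 1) = Suc (Suc (b + c))" "nat B = Suc b"
      "nat (A - B) = c" "nat (A + 1 - B) = Suc c" "nat (B - 1) = b" "nat (A - (B - 1)) = Suc c"
      unfolding A B by auto
    have pw: "q powi (A + 1 - B) = q ^ Suc c"
      by (metis 4(2) add_increasing2 diff_ge_0_iff_ge diff_add_eq nats(5) power_int_def zero_le_one)
    have nz: "1 - q ^ Suc b \<noteq> 0" "1 - q ^ Suc c \<noteq> 0"
      using q_power_neq_1[of "Suc b"] q_power_neq_1[of "Suc c"] by auto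
    have split: "1 - q ^ Suc (Suc (b + c)) = (1 - q ^ Suc c) + q ^ Suc c * (1 - q ^ Suc b)"
      by (simp add: algebra_simps power_add)
    define P where "P = qpoch q q (Suc (b + c))"
    define u v where "u = qpoch q q b" and "v = qpoch q q c"
    define x y where "x = 1 - q ^ Suc b" and "y = 1 - q ^ Suc c"
    have nz': "u \<noteq> 0" "v \<noteq> 0" "x \<noteq> 0" "y \<noteq> 0"
      using nz by (simp_all add: u_def v_def x_def y_def)
    have "gauss q (A + 1) B = P * (y + q ^ Suc c * x) / (u * x * (v * y))"
      using 4 unfolding gauss_def nats
      by (simp only: qpoch_Suc[of q "Suc (b + c)"] qpoch_Suc[of q b] qpoch_Suc[of q c]
           split P_def u_def v_def x_def y_def) simp
    also have "\<dots> = P / (u * x * v) + q ^ Suc c * (P / (u * (v * y)))"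
      using nz' by (simp add: field_simps)
    also have "P / (u * x * v) = gauss q A B"
      using 4 unfolding gauss_def nats
      by (simp add: qpoch_Suc[of q b] P_def u_def v_def x_def)
    also have "P / (u * (v * y)) = gauss q A (B - 1)"
      using 4 unfolding gauss_def nats
      by (simp add: qpoch_Suc[of q c] P_def u_def v_def y_def)
    finally show ?thesis by (simp only: pw)
  qed (use assms in \<open>auto simp: gauss_outside gauss_0_right gauss_self\<close>)
qed

lemma gauss_pascal_lower:
  assumes "A \<ge> 0"
  shows "gauss q (A + 1) B = gauss q A (B - 1) + q powi B * gauss q A B"
proof -
  have "gauss q (A + 1) (A + 1 - B) =
      gauss q A (A - (B - 1)) + q powi B * gauss q A (A - B)"
    using gauss_pascal_upper[OF assms, of "A + 1 - B"] by (simp add: algebra_simps)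
  then show ?thesis by (simp only: gauss_sym)
qed

definition schur_term :: "nat \<Rightarrow> int \<Rightarrow> 'a" where
  "schur_term j k = q powi (6*k^2 + k) * gauss q (2 * int j + 1) (int j - 3*k)
     - q powi (6*k^2 + 7*k + 2) * gauss q (2 * int j + 1) (int j - 1 - 3*k)"

text \<open>
  Passing from \<open>2 * j + 1\<close> to \<open>2 * j + 2\<close> leaves the multiple of \<open>gauss q (2*j + 1) (j + 1 - 3*k)\<close>
  from the first family, minus the same expression at \<open>k + 1\<close> from the second one. Passing on to
  \<open>2 * j + 3\<close> produces equal multiples of \<open>gauss q (2*j + 2) (j - 3*k)\<close> in both families, which cancel.
\<close>

lemma schur_term_step:
  fixes j :: nat
  defines "G \<equiv> \<lambda>k::int. q powi (6*k^2 - 2*k + int j + 1) * gauss q (2 * int j + 1) (int j + 1 - 3*k)"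
  shows "schur_term (Suc j) k = schur_term j k + (G k - G (k + 1))"
proof -
  define g where "g = gauss q (2 * int j + 1)"
  define h where "h = gauss q (2 * int j + 2)"
  define a where "a = 6*k^2 + k"
  define b where "b = 6*k^2 + 7*k + 2"
  have comb: "q powi x * (q powi y * z) = q powi (x + y) * z" for x y z
    by (simp add: power_int_add q_nonzero mult.assoc)
  have h3: "gauss q (2 * int (Suc j) + 1) (int (Suc j) - 3*k)
      = h (int j + 1 - 3*k) + q powi (int j + 2 + 3*k) * h (int j - 3*k)"
    using gauss_pascal_upper[of "2 * int j + 2" "int j + 1 - 3*k"]
    by (simp add: h_def algebra_simps)
  have h4: "gauss q (2 * int (Suc j) + 1) (int (Suc j) - 1 - 3*k)
      = h (int j - 1 - 3*k) + q powi (int j - 3*k) * h (int j - 3*k)"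
    using gauss_pascal_lower[of "2 * int j + 2" "int j - 3*k"]
    by (simp add: h_def algebra_simps)
  have g1: "h (int j + 1 - 3*k) = g (int j - 3*k) + q powi (int j + 1 - 3*k) * g (int j + 1 - 3*k)"
    using gauss_pascal_lower[of "2 * int j + 1" "int j + 1 - 3*k"]
    by (simp add: h_def g_def algebra_simps)
  have g2: "h (int j - 1 - 3*k)
      = g (int j - 1 - 3*k) + q powi (int j + 3 + 3*k) * g (int j - 2 - 3*k)"
    using gauss_pascal_upper[of "2 * int j + 1" "int j - 1 - 3*k"]
    by (simp add: h_def g_def algebra_simps)
  have e1: "a + (int j + 2 + 3*k) = b + (int j - 3*k)"
    by (simp add: a_def b_def algebra_simps)
  have G1: "G k = q powi (a + (int j + 1 - 3*k)) * g (int j + 1 - 3*k)"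
    by (simp add: G_def g_def a_def algebra_simps)
  have "6*(k+1)^2 - 2*(k+1) + int j + 1 = b + (int j + 3 + 3*k)"
    by (simp add: b_def power2_eq_square algebra_simps)
  moreover have "int j + 1 - 3*(k+1) = int j - 2 - 3*k" by simp
  ultimately have G2: "G (k+1) = q powi (b + (int j + 3 + 3*k)) * g (int j - 2 - 3*k)"
    by (simp only: G_def g_def)
  show ?thesis
    unfolding schur_term_def h3 h4 g1 g2 G1 G2 a_def[symmetric] b_def[symmetric]
      g_def[symmetric] distrib_left comb e1
    by simp
qed

text \<open>
  The range only has to be large enough for both ends of the telescoping sum to vanish. Keeping \<open>N\<close>
  independent of \<open>j\<close> gives all \<open>j\<close> a common range, as needed for interchanging the sums over
  \<open>j\<close> and \<open>k\<close>.
\<close>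

theorem sum_schur_term:
  assumes "int j \<le> N"
  shows "(\<Sum>k\<in>{-N..N}. schur_term j k) = 1"
  using assms
proof (induction j)
  case 0
  have "schur_term 0 k = (if k = 0 then 1 else 0)" for k
  proof -
    have "-3*k < 0 \<or> -3*k > 1" if "k \<noteq> 0" using that by arith
    moreover have "-1-3*k < 0 \<or> -1-3*k > 1" by arith
    ultimately show ?thesis by (auto simp: schur_term_def gauss_outside gauss_0_right)
  qed
  then show ?case using 0 by simp
next
  case (Suc j)
  define G where
    "G = (\<lambda>k::int. q powi (6*k^2 - 2*k + int j + 1) * gauss q (2 * int j + 1) (int j + 1 - 3*k))"
  have step: "schur_term (Suc j) k = schur_term j k + (G k - G (k + 1))" for k
    unfolding G_def by (rule schur_term_step)
  have tele: "(\<Sum>k\<in>{-N..N}. G k - G (k + 1)) = G (-N) - G (N + 1)"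
  proof -
    have "sum G {-N..N} = sum (\<lambda>k. G (k + 1)) {-N-1..N-1}"
      by (rule sum.reindex_bij_witness[of _ "\<lambda>k. k + 1" "\<lambda>k. k - 1"]) auto
    also have "{-N-1..N-1} = insert (-N-1) {-N..N-1}" using Suc.prems by auto
    also have "sum (\<lambda>k. G (k + 1)) \<dots> = G (-N) + sum (\<lambda>k. G (k + 1)) {-N..N-1}" by simp
    finally have "sum G {-N..N} = \<dots>" .
    moreover have "{-N..N} = insert N {-N..N-1}" using Suc.prems by auto
    then have "sum (\<lambda>k. G (k + 1)) {-N..N} = G (N + 1) + sum (\<lambda>k. G (k + 1)) {-N..N-1}" by simp
    ultimately show ?thesis by (simp add: sum_subtractf)
  qed
  have "G (-N) = 0" "G (N + 1) = 0"
    using Suc.prems by (auto simp: G_def gauss_outside)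
  with tele have "(\<Sum>k\<in>{-N..N}. schur_term (Suc j) k) = (\<Sum>k\<in>{-N..N}. schur_term j k)"
    by (simp add: step sum.distrib)
  then show ?case using Suc by simp
qed

text \<open>
  The substitution is \<open>j = r + a\<close>, so that \<open>r\<close> and \<open>r + A\<close> become \<open>j - a\<close> and \<open>j + a + 1\<close>, with sum
  \<open>2 * j + 1\<close>.
\<close>

lemma qtrinomial_odd_eq_sum:
  "qtrinomial q L (2*a + 1) (2*a + 1) =
     (\<Sum>j\<le>L. gauss q (int L) (2 * int j + 1) *
        (q powi ((int j - a) * (int j + a + 1)) * gauss q (2 * int j + 1) (int j - a)))"
    (is "_ = (\<Sum>j\<le>L. ?f j)")
proof -
  let ?t = "qtrinomial_term q L (2*a + 1) (2*a + 1)"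
  have "qtrinomial q L (2*a + 1) (2*a + 1) = (\<Sum>r\<le>L. qtrinomial_term q L (2*a + 1) (2*a + 1) r)"
    unfolding qtrinomial_def
    by (rule Sum_any.expand_superset) (auto dest: qtrinomial_term_nonzeroD)
  also have "\<dots> = (\<Sum>r\<in>{r. r \<le> L \<and> ?t r \<noteq> 0}. ?t r)"
    by (rule sum.mono_neutral_right) auto
  also have "\<dots> = (\<Sum>j\<in>{j. j \<le> L \<and> ?f j \<noteq> 0}. ?f j)"
  proof (rule sum.reindex_bij_witness[of _ "\<lambda>j. nat (int j - a)" "\<lambda>r. nat (int r + a)"])
    fix r assume "r \<in> {r. r \<le> L \<and> ?t r \<noteq> 0}"
    then have nz: "?t r \<noteq> 0" by simp
    then have r: "int r + (2*a + 1) \<ge> 0" "int L - 2 * int r - (2*a + 1) \<ge> 0"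
      by (auto simp: qtrinomial_term_def split: if_splits)
    define j where "j = nat (int r + a)"
    have j: "int j = int r + a" using r by (simp add: j_def)
    have jL: "j \<le> L" using r j by linarith
    have c: "2 * int j + 1 - int r = int r + (2*a + 1)"
      "int L - (2 * int j + 1) = int L - 2 * int r - (2*a + 1)"
      "int j + a + 1 = int r + (2*a + 1)" "int j - a = int r" using j by auto
    have rng: "0 \<le> 2 * int j + 1" "2 * int j + 1 \<le> int L" "int r \<le> 2 * int j + 1"
      using r j by auto
    show eq: "?f (nat (int r + a)) = ?t r"
      unfolding j_def[symmetric] c(3,4)
      using r rng unfolding gauss_def qtrinomial_term_def c(1,2)
      by (simp add: field_simps)
    show "nat (int (nat (int r + a)) - a) = r" using j by (simp add: j_def)
    show "nat (int r + a) \<in> {j. j \<le> L \<and> ?f j \<noteq> 0}"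
      unfolding mem_Collect_eq eq using jL[unfolded j_def] nz by blast
  next
    fix j assume "j \<in> {j. j \<le> L \<and> ?f j \<noteq> 0}"
    then have nz: "?f j \<noteq> 0" by simp
    then have j: "2 * int j + 1 \<le> int L" "int j - a \<ge> 0" "int j - a \<le> 2 * int j + 1"
      using gauss_outside[of "2 * int j + 1" "int L" q]
        gauss_outside[of "int j - a" "2 * int j + 1" q] by force+
    define r where "r = nat (int j - a)"
    have r: "int r = int j - a" using j by (simp add: r_def)
    show "nat (int (nat (int j - a)) + a) = j" using r by (simp add: r_def)
    have "?t r \<noteq> 0"
      using j r by (simp add: qtrinomial_term_def q_nonzero)
    moreover have "r \<le> L" using r j by linarith
    ultimately show "nat (int j - a) \<in> {r. r \<le> L \<and> ?t r \<noteq> 0}"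
      by (simp add: r_def)
  qed
  also have "\<dots> = (\<Sum>j\<le>L. ?f j)"
    by (rule sum.mono_neutral_left) auto
  finally show ?thesis .
qed

text \<open>
  The two \<open>q\<close>-trinomial coefficients are the cases \<open>a = 3*k\<close> and \<open>a = 3*k + 1\<close> of the preceding lemma.
  Since \<open>(j - a) * (j + a + 1) = j * (j + 1) - a * (a + 1)\<close>, the exponents \<open>15*k\<^sup>2 + 4*k\<close> and
  \<open>15*k\<^sup>2 + 16*k + 4\<close>, diminished by \<open>a * (a + 1)\<close>, become those of \<open>schur_term\<close>.
\<close>

lemma qtrinomial_difference_eq_sum:
  "q powi (15*k^2 + 4*k) * qtrinomial q L (6*k + 1) (6*k + 1)
     - q powi (15*k^2 + 16*k + 4) * qtrinomial q L (6*k + 3) (6*k + 3)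
   = (\<Sum>j\<le>L. q ^ (j * (j + 1)) * gauss q (int L) (2 * int j + 1) * schur_term j k)"
proof -
  have comb: "q powi x * (g * (q powi y * z)) = q ^ (j * (j + 1)) * g * (q powi w * z)"
    if "x + y = int j * (int j + 1) + w" for x y w g z and j :: nat
  proof -
    have "q powi x * q powi y = q powi (int j * (int j + 1)) * q powi w"
      using that by (metis power_int_add q_nonzero)
    also have "q powi (int j * (int j + 1)) = q ^ (j * (j + 1))"
    proof -
      have "int j * (int j + 1) = int (j * (j + 1))" by (simp add: algebra_simps)
      then show ?thesis by (simp only: power_int_of_nat)
    qed
    finally show ?thesis by (metis mult.assoc mult.left_commute)
  qed
  have a: "2 * (3*k) + 1 = 6*k + 1" "2 * (3*k + 1) + 1 = 6*k + 3" by auto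
  have 1: "q powi (15*k^2 + 4*k) * qtrinomial q L (6*k + 1) (6*k + 1)
      = (\<Sum>j\<le>L. q ^ (j * (j + 1)) * gauss q (int L) (2 * int j + 1) *
          (q powi (6*k^2 + k) * gauss q (2 * int j + 1) (int j - 3*k)))"
    unfolding qtrinomial_odd_eq_sum[of L "3*k", unfolded a] sum_distrib_left
    by (intro sum.cong refl comb) (simp add: power2_eq_square algebra_simps)
  have m: "int j - (3*k + 1) = int j - 1 - 3*k" for j by simp
  have 2: "q powi (15*k^2 + 16*k + 4) * qtrinomial q L (6*k + 3) (6*k + 3)
      = (\<Sum>j\<le>L. q ^ (j * (j + 1)) * gauss q (int L) (2 * int j + 1) *
          (q powi (6*k^2 + 7*k + 2) * gauss q (2 * int j + 1) (int j - 1 - 3*k)))"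
    unfolding qtrinomial_odd_eq_sum[of L "3*k + 1", unfolded a] sum_distrib_left m
    by (intro sum.cong refl comb) (simp add: power2_eq_square algebra_simps)
  show ?thesis
    unfolding 1 2 schur_term_def right_diff_distrib sum_subtractf ..
qed

theorem sum_gauss_eq_sum_qtrinomial:
  "Sum_any (\<lambda>j::nat. q ^ (j * (j + 1)) * gauss q (int L) (2 * int j + 1)) =
    Sum_any (\<lambda>k::int.
        q powi (15 * k^2 + 4 * k) * qtrinomial q L (6 * k + 1) (6 * k + 1)
      - q powi (15 * k^2 + 16 * k + 4) * qtrinomial q L (6 * k + 3) (6 * k + 3))"
    (is "?lhs = Sum_any ?t")
proof -
  define w where "w = (\<lambda>j::nat. q ^ (j * (j + 1)) * gauss q (int L) (2 * int j + 1))"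
  have "Sum_any ?t = (\<Sum>k\<in>{- int L..int L}. ?t k)"
  proof (rule Sum_any.expand_superset)
    show "{k. ?t k \<noteq> 0} \<subseteq> {- int L..int L}"
    proof (rule subsetI, rule ccontr)
      fix k assume k: "k \<in> {k. ?t k \<noteq> 0}" "k \<notin> {- int L..int L}"
      then have "\<bar>6*k + 1\<bar> > int L" "\<bar>6*k + 3\<bar> > int L" by auto
      with k(1) show False by (simp add: qtrinomial_eq_0)
    qed
  qed simp
  also have "\<dots> = (\<Sum>k\<in>{- int L..int L}. \<Sum>j\<le>L. w j * schur_term j k)"
    by (simp only: qtrinomial_difference_eq_sum w_def)
  also have "\<dots> = (\<Sum>j\<le>L. w j * (\<Sum>k\<in>{- int L..int L}. schur_term j k))"
    by (subst sum.swap) (simp only: sum_distrib_left)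
  also have "\<dots> = (\<Sum>j\<le>L. w j)"
    by (intro sum.cong) (simp_all add: sum_schur_term)
  also have "\<dots> = ?lhs"
    unfolding w_def
    by (rule Sum_any.expand_superset[symmetric]) (auto simp: gauss_def split: if_splits)
  finally show ?thesis ..
qed

end

interpretation indet: non_root_of_unity indet
proof
  show "indet \<noteq> 0" by (simp add: indet_def)
qed (rule indet_power_neq_1)

theorem mainTheorem18:
  fixes n :: nat
  shows "Sum_any (\<lambda>j::nat. indet ^ (j * (j + 1)) * gauss indet (int n + 1) (2 * int j + 1)) =
    Sum_any (\<lambda>k::int.
        indet powi (15 * k^2 + 4 * k) * qtrinomial indet (n + 1) (6 * k + 1) (6 * k + 1)
      - indet powi (15 * k^2 + 16 * k + 4) * qtrinomial indet (n + 1) (6 * k + 3) (6 * k + 3))"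
  using indet.sum_gauss_eq_sum_qtrinomial[of "n + 1"] by (simp only: of_nat_add of_nat_1)

end
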